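(* Let $(f,g)$ be an admissible pair on $\Omega$ with associated holomorphic function $A$ and constants $k,c_0$ (as defined in the context), and suppose $k>0$ and $c_0=0$. Then there are constants $c_1\in\mathbb{C}$, $\lambda>0$, $\mu>0$, $C_2,D\in\mathbb{R}$ and $\epsilon_0\in\{1,-1\}$ such that, with $z=x+iy$, $f$ is the catenoid $$f=\frac{\epsilon_0}{\lambda}\cosh^{-1}\!\big[\lambda|c_1+z|\big]-C_2\quad\text{on }\Omega,$$ with first characteristic function $h(s)=-2\lambda\,\operatorname{csch}\big(2\lambda[s+C_2]\big)$; the transformation is $$g(s)=\frac{\pm1}{\lambda\mu}\cosh^{-1}\!\big(\mu\cosh[\lambda(s+C_2)]\big)+D\quad\text{for } s\in f(\Omega);$$ and the transformed minimal graph surface is again a catenoid, given by $$g\circ f=\frac{\pm1}{\lambda\mu}\cosh^{-1}\!\big(\lambda\mu|c_1+z|\big)+D .$$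
   Context: A minimal graph surface is a smooth $f:\Omega\to\mathbb{R}$ on an open connected $\Omega\subseteq\mathbb{R}^2\cong\mathbb{C}$ satisfying $(1+f_y^2)f_{xx}-2f_{xy}f_xf_y+(1+f_x^2)f_{yy}=0$. A smooth map $g:U\to\mathbb{R}$ ($U\subseteq\mathbb{R}$ open) is a minimal graph transformation of $f$ if $f(\Omega)\subseteq U$ and $g\circ f$ is a minimal graph surface. Admissible pair: $\Omega$ is simply connected, $f:\Omega\to\mathbb{R}$ is a minimal graph surface with $\|\nabla f\|^2$ nowhere zero, $g:U\to\mathbb{R}$ is a minimal graph transformation of $f$ with $g'^3-g'$ nowhere zero on $U$, and the first characteristic function $h=\frac{g''}{g'^3-g'}$ (which satisfies $\Delta f/\|\nabla f\|^2=h(f)$) is nowhere zero on $I=f(\Omega)$. Associated $A$, $k$, $c_0$: let $H_1$ be an antiderivative of $h$ on $I$ and $H$ an antiderivative of $e^{-H_1}$. Then $u=H\circ f$ is harmonic with $u_z\neq0$; write $u=A+\overline{A}$ with $A$ holomorphic on $\Omega$. The function $A$ satisfies $[\ln A'(z)]_{zz}=k\,[A'(z)]^2$, i.e. $A'''A'-(A'')^2=k(A')^4$, for a real constant $k$. Consequently $c_0:=\big(\tfrac{A''}{A'}\big)^2-k(A')^2$ is a complex constant. (For $k\neq 0$, with $\mathcal{B}=\ln(\sqrt{|k|}A')$, this says $\mathcal{B}_z^2=\operatorname{sgn}(k)e^{2\mathcal{B}}+c_0$.) The sign of $k$ and the value of $c_0$ do not depend on the choice of integration constants. $\cosh^{-1}:[1,\infty)\to[0,\infty)$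 is the principal inverse. *)

theory Defs
  imports "HOL-Analysis.Analysis"
begin

text \<open>
  Points of the plane are complex numbers: the coordinate directions are \<open>1\<close> and \<open>\<i>\<close>.
  Functions are total in HOL; everything is read only on the stated open domain.
\<close>

text \<open>\<open>C\<^sup>k\<close> on an open set: all iterated directional derivatives up to order \<open>k\<close> exist and are
  continuous.\<close>

primrec Ck_on :: "nat \<Rightarrow> ('a::real_normed_vector \<Rightarrow> 'b::real_normed_vector) \<Rightarrow> 'a set \<Rightarrow> bool" where
  "Ck_on 0 f S \<longleftrightarrow> continuous_on S f"
| "Ck_on (Suc n) f S \<longleftrightarrow>
     (\<forall>x\<in>S. f differentiable (at x)) \<and> (\<forall>v. Ck_on n (\<lambda>x. frechet_derivative f (at x) v) S)"

definition smooth_on :: "('a::real_normed_vector \<Rightarrow> 'b::real_normed_vector) \<Rightarrow> 'a set \<Rightarrow> bool" where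
  "smooth_on f S \<longleftrightarrow> (\<forall>n. Ck_on n f S)"

definition Dx :: "(complex \<Rightarrow> real) \<Rightarrow> complex \<Rightarrow> real" where
  "Dx f z = frechet_derivative f (at z) 1"

definition Dy :: "(complex \<Rightarrow> real) \<Rightarrow> complex \<Rightarrow> real" where
  "Dy f z = frechet_derivative f (at z) \<i>"

definition minimal_graph_surface :: "complex set \<Rightarrow> (complex \<Rightarrow> real) \<Rightarrow> bool" where
  "minimal_graph_surface \<Omega> f \<longleftrightarrow>
     open \<Omega> \<and> connected \<Omega> \<and> smooth_on f \<Omega> \<and>
     (\<forall>z\<in>\<Omega>. (1 + (Dy f z)\<^sup>2) * Dx (Dx f) z
            - 2 * Dy (Dx f) z * Dx f z * Dy f z
            + (1 + (Dx f z)\<^sup>2) * Dy (Dy f) z = 0)"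

definition minimal_graph_transformation ::
  "complex set \<Rightarrow> (complex \<Rightarrow> real) \<Rightarrow> real set \<Rightarrow> (real \<Rightarrow> real) \<Rightarrow> bool" where
  "minimal_graph_transformation \<Omega> f U g \<longleftrightarrow>
     open U \<and> smooth_on g U \<and> f ` \<Omega> \<subseteq> U \<and> minimal_graph_surface \<Omega> (g \<circ> f)"

definition first_char :: "(real \<Rightarrow> real) \<Rightarrow> real \<Rightarrow> real" where
  "first_char g s = deriv (deriv g) s / ((deriv g s)^3 - deriv g s)"

definition admissible_pair ::
  "complex set \<Rightarrow> (complex \<Rightarrow> real) \<Rightarrow> real set \<Rightarrow> (real \<Rightarrow> real) \<Rightarrow> bool" where
  "admissible_pair \<Omega> f U g \<longleftrightarrow>
     simply_connected \<Omega> \<and>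
     minimal_graph_surface \<Omega> f \<and>
     (\<forall>z\<in>\<Omega>. (Dx f z)\<^sup>2 + (Dy f z)\<^sup>2 \<noteq> 0) \<and>
     minimal_graph_transformation \<Omega> f U g \<and>
     (\<forall>s\<in>U. (deriv g s)^3 - deriv g s \<noteq> 0) \<and>
     (\<forall>s\<in>f ` \<Omega>. first_char g s \<noteq> 0)"

text \<open>\<open>A\<close> is an associated holomorphic function of \<open>(f, g)\<close>, for some choice of the
  antiderivatives \<open>H1\<close> and \<open>H\<close>.\<close>

definition associated_holomorphic ::
  "complex set \<Rightarrow> (complex \<Rightarrow> real) \<Rightarrow> (real \<Rightarrow> real) \<Rightarrow> (complex \<Rightarrow> complex) \<Rightarrow> bool" where
  "associated_holomorphic \<Omega> f g A \<longleftrightarrow>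
     A holomorphic_on \<Omega> \<and>
     (\<exists>H1 H :: real \<Rightarrow> real.
        (\<forall>s\<in>f ` \<Omega>. (H1 has_real_derivative first_char g s) (at s within f ` \<Omega>)) \<and>
        (\<forall>s\<in>f ` \<Omega>. (H has_real_derivative exp (- H1 s)) (at s within f ` \<Omega>)) \<and>
        (\<forall>z\<in>\<Omega>. complex_of_real (H (f z)) = A z + cnj (A z)))"

text \<open>For an associated \<open>A\<close>, \<open>deriv A\<close> has no zero on \<open>\<Omega>\<close>, so the following two relations
  determine \<open>k\<close> and \<open>c0\<close> uniquely (for nonempty \<open>\<Omega>\<close>).\<close>

definition associated_k :: "complex set \<Rightarrow> (complex \<Rightarrow> complex) \<Rightarrow> real \<Rightarrow> bool" where
  "associated_k \<Omega> A k \<longleftrightarrow>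
     (\<forall>z\<in>\<Omega>. deriv (deriv (deriv A)) z * deriv A z - (deriv (deriv A) z)\<^sup>2
            = complex_of_real k * (deriv A z)^4)"

definition associated_c0 :: "complex set \<Rightarrow> (complex \<Rightarrow> complex) \<Rightarrow> real \<Rightarrow> complex \<Rightarrow> bool" where
  "associated_c0 \<Omega> A k c0 \<longleftrightarrow>
     (\<forall>z\<in>\<Omega>. (deriv (deriv A) z / deriv A z)\<^sup>2 - complex_of_real k * (deriv A z)\<^sup>2 = c0)"

definition csch :: "real \<Rightarrow> real" where
  "csch x = 1 / sinh x"

end

theory Submission
  imports Defs "HOL-Complex_Analysis.Cauchy_Integral_Formula"
begin

text \<open>
  For \<open>c\<^sub>0 = 0\<close> the function \<open>A'' / A'\<^sup>2\<close> is a continuous square root of the constant \<open>k\<close>, hence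
  constant, so \<open>A' = (a / 2) / (c + z)\<close> with \<open>a\<close> real and \<open>\<bar>c + z\<bar> = C exp (H(f) / a)\<close>. Thus
  \<open>\<nabla>f = a exp (H\<^sub>1(f)) \<nabla>ln \<bar>c + z\<bar>\<close>, and the minimal surface equation for \<open>f\<close> collapses to
  \<open>h(f) = - a exp (H\<^sub>1(f)) / \<bar>c + z\<bar>\<^sup>2\<close>. As functions of \<open>s = f\<close>, the radius \<open>R = \<bar>c + z\<bar>\<close> and
  \<open>q = exp (- H\<^sub>1)\<close> satisfy \<open>R' = R q / a\<close> and \<open>q' = a / R\<^sup>2\<close>, with first integral
  \<open>q\<^sup>2 + a\<^sup>2 / R\<^sup>2 = \<lambda>\<^sup>2 a\<^sup>2\<close>, which makes \<open>arcosh (\<lambda> R)\<close> affine in \<open>s\<close>. Finally, with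
  \<open>\<theta> = \<lambda> (s + C\<^sub>2)\<close>, the equation \<open>g'' = h (g'\<^sup>3 - g')\<close> has the first integral
  \<open>(1 + sinh\<^sup>2 \<theta> / g'\<^sup>2) / cosh\<^sup>2 \<theta> = \<mu>\<^sup>2\<close>, and a second integration gives \<open>g\<close>.
\<close>

section \<open>Holomorphic data: the shape of \<open>A'\<close> and the modulus of
  \<open>c + z\<close>\<close>

text \<open>The derivative of \<open>1 / A'\<close> is \<open>- A'' / A'^2\<close>, a constant with
  square \<open>k\<close>, so \<open>1 / A'\<close> is affine. As \<open>k > 0\<close>, this
  constant is real, which makes \<open>a\<close> real. The factor 1/2 appears because the potential
  is \<open>2 Re A\<close>: it becomes \<open>a ln |c + z|\<close> up to a constant.\<close>

lemma riccati_derivative: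
  fixes A :: "complex \<Rightarrow> complex" and k :: real
  assumes "open S" "connected S" "S \<noteq> {}" "A holomorphic_on S" "k > 0"
    and nz: "\<And>z. z \<in> S \<Longrightarrow> deriv A z \<noteq> 0"
    and riccati: "\<And>z. z \<in> S \<Longrightarrow>
      (deriv (deriv A) z / deriv A z)\<^sup>2 = complex_of_real k * (deriv A z)\<^sup>2"
  obtains a :: real and c :: complex
  where "a \<noteq> 0" "\<And>z. z \<in> S \<Longrightarrow> c + z \<noteq> 0"
    "\<And>z. z \<in> S \<Longrightarrow> deriv A z = of_real (a / 2) / (c + z)"
proof -
  have hol1: "deriv A holomorphic_on S"
    using assms by (intro holomorphic_deriv)
  have hol2: "deriv (deriv A) holomorphic_on S"
    using hol1 assms by (intro holomorphic_deriv)
  define \<phi> where "\<phi> z = deriv (deriv A) z / (deriv A z)\<^sup>2" for z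
  have \<phi>_sq: "\<phi> z = of_real (sqrt k) \<or> \<phi> z = - of_real (sqrt k)" if "z \<in> S" for z
  proof -
    have "(\<phi> z)\<^sup>2 = (deriv (deriv A) z / deriv A z)\<^sup>2 / (deriv A z)\<^sup>2"
      by (simp add: \<phi>_def power2_eq_square)
    also have "\<dots> = (of_real (sqrt k))\<^sup>2"
      using riccati[OF that] nz[OF that] \<open>k > 0\<close> by (simp flip: of_real_power)
    finally show ?thesis by (simp add: power2_eq_iff)
  qed
  have "\<phi> constant_on S"
  proof (rule continuous_finite_range_constant)
    show "continuous_on S \<phi>"
      unfolding \<phi>_def using nz hol1 hol2
      by (intro continuous_on_divide continuous_on_power holomorphic_on_imp_continuous_on) auto
    have "\<phi> ` S \<subseteq> {of_real (sqrt k), - of_real (sqrt k)}"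
      using \<phi>_sq by auto
    then show "finite (\<phi> ` S)" by (rule finite_subset) simp
  qed fact
  then obtain \<kappa> where \<kappa>: "\<And>z. z \<in> S \<Longrightarrow> \<phi> z = \<kappa>"
    unfolding constant_on_def by auto
  with \<phi>_sq \<open>S \<noteq> {}\<close> have "\<kappa> = of_real (sqrt k) \<or> \<kappa> = - of_real (sqrt k)"
    by fastforce
  then have "\<exists>r::real. \<kappa> = of_real r \<and> r \<noteq> 0"
    using \<open>k > 0\<close> by (auto intro: exI[of _ "sqrt k"] exI[of _ "- sqrt k"])
  then obtain \<kappa>r :: real where \<kappa>r: "\<kappa> = of_real \<kappa>r" "\<kappa>r \<noteq> 0" by blast
  have der: "((\<lambda>z. inverse (deriv A z) + \<kappa> * z) has_field_derivative 0) (at z)"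
    if "z \<in> S" for z
  proof -
    have "((\<lambda>z. inverse (deriv A z) + \<kappa> * z) has_field_derivative
        - (inverse (deriv A z) * deriv (deriv A) z * inverse (deriv A z)) + \<kappa>) (at z)"
      by (intro DERIV_add DERIV_inverse' DERIV_cmult_Id holomorphic_derivI[OF hol1 \<open>open S\<close> that] nz[OF that])
    moreover have "inverse (deriv A z) * deriv (deriv A) z * inverse (deriv A z) = \<kappa>"
      using \<kappa>[OF that] by (simp add: \<phi>_def power2_eq_square divide_inverse mult_ac)
    ultimately show ?thesis by simp
  qed
  obtain C where C: "\<And>z. z \<in> S \<Longrightarrow> inverse (deriv A z) + \<kappa> * z = C"
    using has_field_derivative_0_imp_constant_on[OF der \<open>connected S\<close> \<open>open S\<close>]
    unfolding constant_on_def by blast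
  \<comment> \<open>Solves \<open>1 / A' = C - \<kappa> z = - \<kappa> (c + z)\<close> for
    \<open>c\<close>; then \<open>a / 2\<close> has to be \<open>- 1 / \<kappa>\<close>.\<close>
  define c where "c = - C / \<kappa>"
  have inv: "inverse (deriv A z) = - \<kappa> * (c + z)" if "z \<in> S" for z
    using C[OF that] \<kappa>r by (auto simp: c_def algebra_simps)
  show ?thesis
  proof (rule that[of "- 2 / \<kappa>r" c])
    fix z assume z: "z \<in> S"
    show "c + z \<noteq> 0" using inv[OF z] nz[OF z] by auto
    have "deriv A z = inverse (- \<kappa> * (c + z))"
      by (metis inv[OF z] inverse_inverse_eq)
    also have "\<dots> = - inverse \<kappa> / (c + z)" by (simp add: divide_inverse)
    also have "- inverse \<kappa> = of_real (- 2 / \<kappa>r / 2)" unfolding \<kappa>r(1) by (simp flip: inverse_eq_divide)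
    finally show "deriv A z = of_real (- 2 / \<kappa>r / 2) / (c + z)" .
  qed (use \<kappa>r in auto)
qed

text \<open>The function \<open>(c + z) exp (- 2 A / a)\<close> has derivative zero; using it in
  place of a logarithm of \<open>c + z\<close> avoids choosing a branch. Its constant value has
  modulus \<open>C\<close>.\<close>

lemma modulus_of_log_potential:
  fixes A :: "complex \<Rightarrow> complex" and a :: real
  assumes "open S" "connected S" "S \<noteq> {}" "A holomorphic_on S" "a \<noteq> 0"
    and nz: "\<And>z. z \<in> S \<Longrightarrow> c + z \<noteq> 0"
    and A': "\<And>z. z \<in> S \<Longrightarrow> deriv A z = of_real (a / 2) / (c + z)"
  obtains C :: real where "C > 0" "\<And>z. z \<in> S \<Longrightarrow> cmod (c + z) = C * exp (2 * Re (A z) / a)"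
proof -
  define b :: complex where "b = of_real (2 / a)"
  define F where "F z = (c + z) * exp (- b * A z)" for z
  have der: "(F has_field_derivative 0) (at z)" if "z \<in> S" for z
  proof -
    have "(A has_field_derivative deriv A z) (at z)"
      by (rule holomorphic_derivI[OF \<open>A holomorphic_on S\<close> \<open>open S\<close> that])
    then have "(F has_field_derivative
        exp (- b * A z) * (1 - b * (of_real (a / 2) / (c + z)) * (c + z))) (at z)"
      unfolding F_def A'[OF that, symmetric] by (auto intro!: derivative_eq_intros simp: algebra_simps)
    moreover have "b * (t / (c + z)) * (c + z) = b * t" for t
      using nz[OF that] by simp
    moreover have "b * of_real (a / 2) = 1"
      unfolding b_def of_real_mult[symmetric] using \<open>a \<noteq> 0\<close> by simp
    ultimately show ?thesis by (metis diff_self mult_zero_right)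
  qed
  obtain K where K: "\<And>z. z \<in> S \<Longrightarrow> F z = K"
    using has_field_derivative_0_imp_constant_on[OF der \<open>connected S\<close> \<open>open S\<close>]
    unfolding constant_on_def by blast
  have "K \<noteq> 0" using K nz \<open>S \<noteq> {}\<close> by (auto simp: F_def)
  show ?thesis
  proof (rule that[of "cmod K"])
    fix z assume z: "z \<in> S"
    have "cmod K = cmod (c + z) * exp (- (2 * Re (A z) / a))"
      unfolding K[OF z, symmetric] F_def norm_mult norm_exp_eq_Re by (simp add: b_def)
    then show "cmod (c + z) = cmod K * exp (2 * Re (A z) / a)"
      by (simp add: exp_minus)
  qed (use \<open>K \<noteq> 0\<close> in auto)
qed

section \<open>Derivatives of \<open>f\<close> up to second order and the minimal surface
  equation\<close>

text \<open>Differentiate \<open>H (f w) = 2 Re (A w)\<close> along \<open>v\<close>.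
  \<open>H\<close> is differentiable only within the image of \<open>f\<close>, so the chain rule is
  applied within \<open>S\<close>; openness of \<open>S\<close> then gives the full
  derivative.\<close>

lemma directional_derivative_of_potential:
  fixes f :: "complex \<Rightarrow> real" and H :: "real \<Rightarrow> real"
  assumes "open S" "z \<in> S" "A holomorphic_on S" "f differentiable (at z)"
    and H: "(H has_real_derivative p) (at (f z) within f ` S)"
    and u: "\<And>w. w \<in> S \<Longrightarrow> complex_of_real (H (f w)) = A w + cnj (A w)"
  shows "p * frechet_derivative f (at z) v = 2 * Re (deriv A z * v)"
proof -
  have f: "(f has_derivative frechet_derivative f (at z)) (at z within S)"
    using assms(4) frechet_derivative_works has_derivative_at_withinI by blast
  have "((\<lambda>w. H (f w)) has_derivative (\<lambda>v. p * frechet_derivative f (at z) v)) (at z within S)"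
    using has_derivative_in_compose[OF f] H unfolding has_field_derivative_def by blast
  then have 1: "((\<lambda>w. H (f w)) has_derivative (\<lambda>v. p * frechet_derivative f (at z) v)) (at z)"
    unfolding at_within_open[OF assms(2,1)] .
  have "(A has_derivative (*) (deriv A z)) (at z)"
    using holomorphic_derivI[OF assms(3,1,2)] by (simp add: has_field_derivative_def)
  from bounded_linear.has_derivative[OF bounded_linear_Re this]
  have "((\<lambda>w. 2 * Re (A w)) has_derivative (\<lambda>v. 2 * Re (deriv A z * v))) (at z)"
    by (rule has_derivative_mult_right)
  moreover have "2 * Re (A w) = H (f w)" if "w \<in> S" for w
    using u[OF that] by (metis Re_complex_of_real complex_add_cnj)
  ultimately have "((\<lambda>w. H (f w)) has_derivative (\<lambda>v. 2 * Re (deriv A z * v))) (at z)"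
    by (rule has_derivative_transform_within_open[OF _ assms(1,2)])
  with 1 show ?thesis by (metis has_derivative_unique)
qed

text \<open>One computation serves both partial derivatives of \<open>f\<close>: \<open>l\<close>
  will be \<open>Re\<close> for \<open>Dx f\<close> and \<open>Im\<close> for \<open>Dy f\<close>,
  and \<open>L\<close> will be \<open>H1\<close> composed with \<open>f\<close>. The first term
  comes from the exponential, the second from the quotient of \<open>l\<close> by the squared
  modulus.\<close>

lemma frechet_derivative_radial:
  fixes F L :: "complex \<Rightarrow> real"
  assumes "open S" "z \<in> S" "c + z \<noteq> 0"
    and L: "(L has_derivative L') (at z)"
    and F: "\<And>w. w \<in> S \<Longrightarrow> F w = a * exp (L w) * l (c + w) / (cmod (c + w))\<^sup>2"
    and l: "bounded_linear l"
  shows "frechet_derivative F (at z) v = F z * L' v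
    + a * exp (L z) * (l v / (cmod (c + z))\<^sup>2
        - 2 * l (c + z) * (Re (c + z) * Re v + Im (c + z) * Im v) / (cmod (c + z))^4)"
proof -
  have r: "(cmod (c + w))\<^sup>2 = (Re (c + w))\<^sup>2 + (Im (c + w))\<^sup>2" for w
    by (simp add: cmod_power2)
  have nz: "(Re (c + z))\<^sup>2 + (Im (c + z))\<^sup>2 \<noteq> 0"
    using assms(3) by (metis complex_neq_0 less_irrefl)
  have "((\<lambda>w. c + w) has_derivative (\<lambda>v. v)) (at z)"
    by (auto intro!: derivative_eq_intros)
  then have l': "((\<lambda>w. l (c + w)) has_derivative l) (at z)"
    by (rule bounded_linear.has_derivative[OF l])
  have L2: "((\<lambda>w. exp (L w)) has_derivative (\<lambda>v. exp (L z) * L' v)) (at z)"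
    using L by (auto intro!: derivative_eq_intros)
  define R where "R w = (Re (c + w))\<^sup>2 + (Im (c + w))\<^sup>2" for w
  have R: "(R has_derivative (\<lambda>v. 2 * (Re (c + z) * Re v + Im (c + z) * Im v))) (at z)"
    unfolding R_def by (auto intro!: derivative_eq_intros simp: algebra_simps)
  have Rnz: "R z \<noteq> 0" using nz by (simp add: R_def)
  have "((\<lambda>w. a * exp (L w) * l (c + w) / R w) has_derivative
     (\<lambda>v. a * exp (L z) * l (c + z) / R z * L' v
    + a * exp (L z) * (l v / R z
        - 2 * l (c + z) * (Re (c + z) * Re v + Im (c + z) * Im v) / (R z)\<^sup>2))) (at z)"
    by (rule has_derivative_eq_rhs, (rule derivative_intros l' L2 R Rnz)+)
       (use Rnz in \<open>auto simp: fun_eq_iff power2_eq_square field_simps\<close>)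
  then have "(F has_derivative
     (\<lambda>v. a * exp (L z) * l (c + z) / R z * L' v
    + a * exp (L z) * (l v / R z
        - 2 * l (c + z) * (Re (c + z) * Re v + Im (c + z) * Im v) / (R z)\<^sup>2))) (at z)"
    by (rule has_derivative_transform_within_open[OF _ assms(1,2)]) (simp add: F r R_def)
  from fun_cong[OF frechet_derivative_at[OF this], of v]
  have fd: "frechet_derivative F (at z) v = a * exp (L z) * l (c + z) / R z * L' v
    + a * exp (L z) * (l v / R z
        - 2 * l (c + z) * (Re (c + z) * Re v + Im (c + z) * Im v) / (R z)\<^sup>2)" by simp
  have R2: "(cmod (c + z))\<^sup>2 = R z" by (simp only: R_def r)
  have R4: "cmod (c + z) ^ 4 = (R z)\<^sup>2" by (simp flip: R2)
  show ?thesis unfolding F[OF assms(2)] R2 R4 by (rule fd)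
qed

text \<open>The last assumption is the minimal surface equation with the second derivatives
  of \<open>f\<close> written out by means of \<open>frechet_derivative_radial\<close>.\<close>

lemma minimal_radial_characteristic:
  fixes h p a X Y R fx fy :: real
  assumes "R \<noteq> 0" "R = X\<^sup>2 + Y\<^sup>2" "p \<noteq> 0" "a \<noteq> 0"
    and "fx = a * p * X / R" "fy = a * p * Y / R"
    and "(1 + fy\<^sup>2) * (h * fx\<^sup>2 + a * p * (1 / R - 2 * X\<^sup>2 / R\<^sup>2))
      - 2 * (h * fx * fy - 2 * a * p * X * Y / R\<^sup>2) * fx * fy
      + (1 + fx\<^sup>2) * (h * fy\<^sup>2 + a * p * (1 / R - 2 * Y\<^sup>2 / R\<^sup>2)) = 0"
  shows "h = - a * p / R"
proof -
  have XY: "X\<^sup>2 + Y\<^sup>2 = R" by (simp add: assms)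
  \<comment> \<open>In the coefficient of \<open>h\<close> the products of degree four cancel. The
    expression \<open>2 / R - 2 (X^2 + Y^2) / R^2\<close> is the Laplacian of
    \<open>ln |c + z|\<close>, and the last square vanishes because the gradient is radial.\<close>
  have expand: "(1 + fy\<^sup>2) * (h * fx\<^sup>2 + a * p * (1 / R - 2 * X\<^sup>2 / R\<^sup>2))
      - 2 * (h * fx * fy - 2 * a * p * X * Y / R\<^sup>2) * fx * fy
      + (1 + fx\<^sup>2) * (h * fy\<^sup>2 + a * p * (1 / R - 2 * Y\<^sup>2 / R\<^sup>2))
    = h * (fx\<^sup>2 + fy\<^sup>2) + a * p * (2 / R - 2 * (X\<^sup>2 + Y\<^sup>2) / R\<^sup>2)
      + a * p * ((fx\<^sup>2 + fy\<^sup>2) / R - 2 * (fy * X - fx * Y)\<^sup>2 / R\<^sup>2)"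
    using \<open>R \<noteq> 0\<close> by (simp add: field_simps power2_eq_square)
  have harmonic: "2 / R - 2 * (X\<^sup>2 + Y\<^sup>2) / R\<^sup>2 = 0"
    unfolding XY using \<open>R \<noteq> 0\<close> by (simp add: power2_eq_square)
  have radial: "fy * X - fx * Y = 0" by (simp add: assms)
  have grad: "fx\<^sup>2 + fy\<^sup>2 = (a * p)\<^sup>2 / R"
  proof -
    have "fx\<^sup>2 + fy\<^sup>2 = (a * p)\<^sup>2 * (X\<^sup>2 + Y\<^sup>2) / R\<^sup>2"
      by (simp add: assms(5,6) power_divide power_mult_distrib add_divide_distrib algebra_simps)
    also have "\<dots> = (a * p)\<^sup>2 / R"
      unfolding XY using \<open>R \<noteq> 0\<close> by (simp add: power2_eq_square)
    finally show ?thesis .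
  qed
  have "h * ((a * p)\<^sup>2 / R) + a * p * ((a * p)\<^sup>2 / R / R) = 0"
    using assms(7) unfolding expand harmonic radial grad by simp
  moreover have "h * t + u * (t / R) = t * (h + u / R)" for t u
    by (simp add: algebra_simps)
  ultimately have "(a * p)\<^sup>2 / R * (h + a * p / R) = 0" by metis
  moreover have "(a * p)\<^sup>2 / R \<noteq> 0" using assms(1,3,4) by simp
  ultimately have "h + a * p / R = 0" by (metis mult_eq_0_iff)
  then show ?thesis by (simp add: eq_neg_iff_add_eq_0)
qed

section \<open>Ordinary differential equations in the height \<open>s\<close>\<close>

text \<open>The hypothesis on \<open>h\<close> closes the system for \<open>R\<close> and
  \<open>q\<close>, since \<open>q' = - q h\<close>. The first integral reads
  \<open>(lam R)^2 - 1 = (q R / a)^2\<close>, so the root in the derivative of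
  \<open>arcosh (lam R)\<close> cancels and leaves the constant slope
  \<open>sgn a * lam\<close>.\<close>

lemma catenoid_profile:
  fixes I :: "real set" and H H1 h :: "real \<Rightarrow> real"
  assumes "convex I" "I \<noteq> {}" "a \<noteq> 0" "C > 0"
    and H1: "\<And>s. s \<in> I \<Longrightarrow> (H1 has_real_derivative h s) (at s within I)"
    and H: "\<And>s. s \<in> I \<Longrightarrow> (H has_real_derivative exp (- H1 s)) (at s within I)"
    and h: "\<And>s. s \<in> I \<Longrightarrow> h s = - a * exp (H1 s) / (C * exp (H s / a))\<^sup>2"
  obtains lam C2 :: real where "lam > 0"
    "\<And>s. s \<in> I \<Longrightarrow> 1 < lam * (C * exp (H s / a))"
    "\<And>s. s \<in> I \<Longrightarrow> s + C2 = sgn a / lam * arcosh (lam * (C * exp (H s / a)))"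
    "\<And>s. s \<in> I \<Longrightarrow> h s = - 2 * lam * csch (2 * lam * (s + C2))"
proof -
  define R where "R s = C * exp (H s / a)" for s
  define q where "q s = exp (- H1 s)" for s
  have Rpos: "R s > 0" and qpos: "q s > 0" for s
    using \<open>C > 0\<close> by (auto simp: R_def q_def)
  have hq: "h s = - a / (q s * (R s)\<^sup>2)" if "s \<in> I" for s
    using h[OF that] by (simp add: q_def R_def exp_minus field_simps)
  have R': "(R has_real_derivative R s * q s / a) (at s within I)" if "s \<in> I" for s
    unfolding R_def q_def using H[OF that] \<open>a \<noteq> 0\<close>
    by (auto intro!: derivative_eq_intros)
  have q': "(q has_real_derivative a / (R s)\<^sup>2) (at s within I)" if "s \<in> I" for s
  proof -
    have "(q has_real_derivative q s * - h s) (at s within I)"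
      unfolding q_def using H1[OF that] by (auto intro!: derivative_eq_intros)
    then show ?thesis using qpos[of s] by (simp add: hq[OF that])
  qed
  have "((\<lambda>s. (q s)\<^sup>2 + a\<^sup>2 / (R s)\<^sup>2) has_real_derivative 0) (at s within I)" if "s \<in> I" for s
    using q'[OF that] R'[OF that] Rpos[of s] \<open>a \<noteq> 0\<close>
    by (auto intro!: derivative_eq_intros simp: field_simps power2_eq_square)
  from has_field_derivative_zero_constant[OF \<open>convex I\<close> this]
  obtain K where K: "\<And>s. s \<in> I \<Longrightarrow> (q s)\<^sup>2 + a\<^sup>2 / (R s)\<^sup>2 = K" by auto
  have "K > 0"
  proof -
    from \<open>I \<noteq> {}\<close> obtain s where "s \<in> I" by auto
    with K[OF this] qpos[of s] show ?thesis
      by (metis add_pos_nonneg zero_le_divide_iff zero_le_power2 zero_less_power)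
  qed
  \<comment> \<open>The absolute value keeps \<open>lam\<close> positive; the sign of
    \<open>a\<close> survives as \<open>sgn a\<close>, the later \<open>\<epsilon>0\<close>.\<close>
  define lam where "lam = sqrt K / \<bar>a\<bar>"
  have lam: "lam > 0" "lam\<^sup>2 = K / a\<^sup>2"
    using \<open>K > 0\<close> \<open>a \<noteq> 0\<close> by (auto simp: lam_def power_divide)
  have lamR: "(lam * R s)\<^sup>2 - 1 = (q s * R s / a)\<^sup>2" if "s \<in> I" for s
    using lam(2) K[OF that, symmetric] Rpos[of s] \<open>a \<noteq> 0\<close>
    by (simp add: power_mult_distrib power_divide field_simps)
  \<comment> \<open>The inequality is strict because \<open>q R\<close> is nonzero; the derivative
    rule for \<open>arcosh\<close> needs this.\<close>
  have gt1: "1 < lam * R s" if "s \<in> I" for s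
  proof -
    have "(q s * R s / a)\<^sup>2 > 0" using Rpos[of s] qpos[of s] \<open>a \<noteq> 0\<close> by simp
    then have "1\<^sup>2 < (lam * R s)\<^sup>2" using lamR[OF that] unfolding power_one by linarith
    then show ?thesis
      by (rule power2_less_imp_less) (use lam(1) Rpos[of s] in simp)
  qed
  have sq: "sqrt ((lam * R s)\<^sup>2 - 1) = q s * R s / \<bar>a\<bar>" if "s \<in> I" for s
    unfolding lamR[OF that] using Rpos[of s] qpos[of s] by (simp add: abs_mult abs_divide)
  have "((\<lambda>s. arcosh (lam * R s) - sgn a * lam * s) has_real_derivative 0) (at s within I)"
    if "s \<in> I" for s
  proof -
    have "((\<lambda>s. arcosh (lam * R s)) has_real_derivative
        1 / sqrt ((lam * R s)\<^sup>2 - 1) * (lam * (R s * q s / a))) (at s within I)"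
      by (rule DERIV_chain2[OF arcosh_real_has_field_derivative[OF gt1[OF that]]
          DERIV_cmult[OF R'[OF that]]])
    also have "1 / sqrt ((lam * R s)\<^sup>2 - 1) * (lam * (R s * q s / a)) = sgn a * lam"
      unfolding sq[OF that] using Rpos[of s] qpos[of s] \<open>a \<noteq> 0\<close>
      by (auto simp: field_simps sgn_if)
    finally show ?thesis by (auto intro!: derivative_eq_intros)
  qed
  from has_field_derivative_zero_constant[OF \<open>convex I\<close> this]
  obtain E where E: "\<And>s. s \<in> I \<Longrightarrow> arcosh (lam * R s) - sgn a * lam * s = E" by auto
  \<comment> \<open>Chosen so that \<open>arcosh (lam R) = sgn a * lam * (s + C2)\<close>.\<close>
  define C2 where "C2 = sgn a * E / lam"
  have sC2: "s + C2 = sgn a / lam * arcosh (lam * R s)" if "s \<in> I" for s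
  proof -
    have arcosh: "arcosh (lam * R s) = E + sgn a * lam * s" using E[OF that] by simp
    show ?thesis
      unfolding arcosh using lam(1) \<open>a \<noteq> 0\<close>
      by (cases a "0::real" rule: linorder_cases) (simp_all add: C2_def field_simps)
  qed
  have "h s = - 2 * lam * csch (2 * lam * (s + C2))" if "s \<in> I" for s
  proof -
    \<comment> \<open>With \<open>\<theta> = lam (s + C2)\<close> one has
      \<open>sinh \<theta> = q R / a\<close> and \<open>cosh \<theta> = lam R\<close>; the
      double-angle formula turns \<open>h = - a / (q R^2)\<close> into the \<open>csch\<close>
      expression.\<close>
    have double: "2 * lam * (s + C2) = 2 * (sgn a * arcosh (lam * R s))"
      using lam(1) by (simp add: sC2[OF that])
    have "sinh (sgn a * arcosh (lam * R s)) = q s * R s / a"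
      using sq[OF that] gt1[OF that] \<open>a \<noteq> 0\<close> by (auto simp: sgn_if sinh_arcosh_real)
    moreover have "cosh (sgn a * arcosh (lam * R s)) = lam * R s"
      using gt1[OF that] \<open>a \<noteq> 0\<close> by (auto simp: sgn_if)
    ultimately have sinh: "sinh (2 * lam * (s + C2)) = 2 * (q s * R s / a) * (lam * R s)"
      unfolding double sinh_double by simp
    show ?thesis
      unfolding csch_def hq[OF that] sinh
      using lam(1) Rpos[of s] qpos[of s] \<open>a \<noteq> 0\<close>
      by (simp add: field_simps power2_eq_square)
  qed
  with that[of lam C2] lam(1) gt1 sC2 show ?thesis
    unfolding R_def by blast
qed

text \<open>Off zero \<open>sgn\<close> is continuous, and a continuous function with finitely many
  values is constant on a connected set. This fixes the sign of a square root when \<open>g\<close>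
  is integrated.\<close>

lemma convex_nonzero_constant_sgn:
  fixes \<phi> :: "real \<Rightarrow> real"
  assumes "convex I" "continuous_on I \<phi>" "\<And>s. s \<in> I \<Longrightarrow> \<phi> s \<noteq> 0"
  obtains \<sigma> where "\<sigma> \<in> {1, -1}" "\<And>s. s \<in> I \<Longrightarrow> sgn (\<phi> s) = \<sigma>"
proof (cases "I = {}")
  case False
  have "(\<lambda>s. sgn (\<phi> s)) constant_on I"
  proof (rule continuous_finite_range_constant)
    show "connected I" using assms(1) by (rule convex_connected)
    show "continuous_on I (\<lambda>s. sgn (\<phi> s))"
      using assms(2,3) by (auto intro!: continuous_intros)
    have "(\<lambda>s. sgn (\<phi> s)) ` I \<subseteq> {1, 0, -1}" by (auto simp: sgn_if)
    then show "finite ((\<lambda>s. sgn (\<phi> s)) ` I)" by (rule finite_subset) simp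
  qed
  with False assms(3) that show ?thesis
    unfolding constant_on_def by (metis insertCI sgn_real_def ex_in_conv)
qed (use that in blast)

text \<open>By \<open>sinh (2 \<theta>) = 2 S T\<close> with \<open>\<theta> = lam (s + C2)\<close>,
  the equation for \<open>G\<close> gives \<open>v = 1 + S^2 / G^2\<close> the linear equation
  \<open>v' = 2 lam (S / T) v\<close>, which \<open>T^2\<close> solves too; hence
  \<open>v = \<mu>^2 T^2\<close>. Solving for \<open>G\<close> yields, up to sign, the derivative of
  \<open>arcosh (\<mu> T) / (lam \<mu>)\<close>.\<close>

lemma catenoid_transformation:
  fixes I :: "real set" and g G :: "real \<Rightarrow> real"
  assumes "convex I" "I \<noteq> {}" "lam > 0"
    and nz: "\<And>s. s \<in> I \<Longrightarrow> s + C2 \<noteq> 0"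
    and g: "\<And>s. s \<in> I \<Longrightarrow> (g has_real_derivative G s) (at s within I)"
    and G: "\<And>s. s \<in> I \<Longrightarrow>
      (G has_real_derivative - 2 * lam * csch (2 * lam * (s + C2)) * ((G s)^3 - G s)) (at s within I)"
    and Gnz: "\<And>s. s \<in> I \<Longrightarrow> G s \<noteq> 0"
  obtains \<mu> \<sigma> D :: real where "\<mu> > 0" "\<sigma> \<in> {1, -1}"
    "\<And>s. s \<in> I \<Longrightarrow> 1 < \<mu> * cosh (lam * (s + C2))"
    "\<And>s. s \<in> I \<Longrightarrow> g s = \<sigma> / (lam * \<mu>) * arcosh (\<mu> * cosh (lam * (s + C2))) + D"
proof -
  define S where "S s = sinh (lam * (s + C2))" for s
  define T where "T s = cosh (lam * (s + C2))" for s
  have T: "T s > 0" for s by (simp add: T_def)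
  have TS: "(T s)\<^sup>2 = (S s)\<^sup>2 + 1" for s by (simp add: T_def S_def cosh_square_eq)
  have Snz: "S s \<noteq> 0" if "s \<in> I" for s using nz[OF that] \<open>lam > 0\<close> by (simp add: S_def)
  have S': "(S has_real_derivative lam * T s) (at s within I)" for s
    unfolding S_def T_def by (auto intro!: derivative_eq_intros)
  have T': "(T has_real_derivative lam * S s) (at s within I)" for s
    unfolding S_def T_def by (auto intro!: derivative_eq_intros)
  have csch: "- 2 * lam * csch (2 * lam * (s + C2)) = - lam / (S s * T s)" for s
    using sinh_double[of "lam * (s + C2)"]
    by (simp add: csch_def S_def T_def mult.assoc)
  define N where "N s = (1 + (S s)\<^sup>2 / (G s)\<^sup>2) / (T s)\<^sup>2" for s
  have "(N has_real_derivative 0) (at s within I)" if "s \<in> I" for s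
  proof -
    note nzs = Snz[OF that] Gnz[OF that] T[of s]
    have G': "(G has_real_derivative - lam / (S s * T s) * ((G s)^3 - G s)) (at s within I)"
      using G[OF that] unfolding csch .
    \<comment> \<open>This is \<open>v' T^2 = v (T^2)'\<close> for \<open>v = 1 + S^2 / G^2\<close>,
      multiplied by \<open>G^4\<close>; it rests on \<open>T^2 - 1 = S^2\<close>.\<close>
    have eq: "(2 * S s * (lam * T s) * (G s)\<^sup>2
          - (S s)\<^sup>2 * (2 * G s * (- lam / (S s * T s) * ((G s)^3 - G s)))) * (T s)\<^sup>2
        = ((G s)\<^sup>2 + (S s)\<^sup>2) * (2 * T s * (lam * S s)) * (G s)\<^sup>2" (is "?l = ?r")
    proof -
      have "?l = 2 * lam * S s * T s * (G s)\<^sup>2 * ((T s)\<^sup>2 + (G s)\<^sup>2 - 1)"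
        using nzs by (simp add: field_simps power2_eq_square power3_eq_cube)
      also have "\<dots> = ?r" by (simp add: TS algebra_simps)
      finally show ?thesis .
    qed
    have "((\<lambda>s. (1 + (S s)\<^sup>2 / (G s)\<^sup>2) / (T s)\<^sup>2) has_real_derivative
      (((2 * S s * (lam * T s) * (G s)\<^sup>2
          - (S s)\<^sup>2 * (2 * G s * (- lam / (S s * T s) * ((G s)^3 - G s)))) / ((G s)\<^sup>2 * (G s)\<^sup>2)) * (T s)\<^sup>2
        - (1 + (S s)\<^sup>2 / (G s)\<^sup>2) * (2 * T s * (lam * S s))) / ((T s)\<^sup>2 * (T s)\<^sup>2)) (at s within I)"
      using nzs by (auto intro!: derivative_eq_intros S' T' G')
    moreover have "((2 * S s * (lam * T s) * (G s)\<^sup>2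
          - (S s)\<^sup>2 * (2 * G s * (- lam / (S s * T s) * ((G s)^3 - G s)))) / ((G s)\<^sup>2 * (G s)\<^sup>2)) * (T s)\<^sup>2
        - (1 + (S s)\<^sup>2 / (G s)\<^sup>2) * (2 * T s * (lam * S s)) = 0"
    proof -
      \<comment> \<open>Abstract factors keep the large terms unexpanded; used with
        \<open>Q = G^2 + S^2\<close>, \<open>e = G^2\<close>, \<open>d = G^4\<close> and
        \<open>B = (T^2)'\<close>.\<close>
      have quotient: "P / d * t - m * B = 0" if "P * t = Q * B * e" "m = Q * e / d"
        for P d t m B Q e :: real
      proof -
        have "P / d * t = P * t / d" by simp
        also have "\<dots> = m * B" unfolding that by (simp add: mult_ac)
        finally show ?thesis by simp
      qed
      have "(1 + (S s)\<^sup>2 / (G s)\<^sup>2) = ((G s)\<^sup>2 + (S s)\<^sup>2) * (G s)\<^sup>2 / ((G s)\<^sup>2 * (G s)\<^sup>2)"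
        using nzs by (simp add: field_simps)
      with eq show ?thesis by (rule quotient)
    qed
    ultimately show ?thesis unfolding N_def by simp
  qed
  from has_field_derivative_zero_constant[OF \<open>convex I\<close> this]
  obtain M where M: "\<And>s. s \<in> I \<Longrightarrow> N s = M" by auto
  have Npos: "N s > 0" for s
    using T[of s] by (simp add: N_def add_pos_nonneg)
  then have "M > 0" using M \<open>I \<noteq> {}\<close> by (metis ex_in_conv)
  define \<mu> where "\<mu> = sqrt M"
  have \<mu>: "\<mu> > 0" "\<mu>\<^sup>2 = M" using \<open>M > 0\<close> by (auto simp: \<mu>_def)
  have \<mu>T: "(\<mu> * T s)\<^sup>2 - 1 = (S s / G s)\<^sup>2" if "s \<in> I" for s
    using T[of s] M[OF that] by (simp add: power_mult_distrib \<mu>(2) N_def power_divide field_simps)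
  have gt1: "1 < \<mu> * T s" if "s \<in> I" for s
  proof -
    have "(S s / G s)\<^sup>2 > 0" using Snz[OF that] Gnz[OF that] by simp
    then have "1\<^sup>2 < (\<mu> * T s)\<^sup>2" using \<mu>T[OF that] unfolding power_one by linarith
    then show ?thesis
      by (rule power2_less_imp_less) (use \<mu>(1) T[of s] in simp)
  qed
  have "continuous_on I (\<lambda>s. S s / G s)"
    using DERIV_continuous[OF G] DERIV_continuous[OF S'] Gnz
    by (auto simp: continuous_on_eq_continuous_within intro!: continuous_intros)
  then obtain \<sigma> where \<sigma>: "\<sigma> \<in> {1, -1}" "\<And>s. s \<in> I \<Longrightarrow> sgn (S s / G s) = \<sigma>"
    using convex_nonzero_constant_sgn[OF \<open>convex I\<close>, of "\<lambda>s. S s / G s"] Snz Gnz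
    by (metis divide_eq_0_iff)
  have "((\<lambda>s. g s - \<sigma> / (lam * \<mu>) * arcosh (\<mu> * T s)) has_real_derivative 0) (at s within I)"
    if "s \<in> I" for s
  proof -
    have "((\<lambda>s. arcosh (\<mu> * T s)) has_real_derivative
        1 / sqrt ((\<mu> * T s)\<^sup>2 - 1) * (\<mu> * (lam * S s))) (at s within I)"
      by (rule DERIV_chain2[OF arcosh_real_has_field_derivative[OF gt1[OF that]] DERIV_cmult[OF T']])
    note d = DERIV_diff[OF g[OF that] DERIV_cmult[OF this, of "\<sigma> / (lam * \<mu>)"]]
    \<comment> \<open>The root equals \<open>|S / G|\<close>; the prefactor \<open>\<sigma>\<close>
      cancels the sign this introduces, leaving exactly \<open>G\<close>.\<close>
    have "\<bar>S s / G s\<bar> = \<sigma> * (S s / G s)"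
      using \<sigma>(2)[OF that] by (metis abs_sgn mult.commute)
    then have "\<sigma> / (lam * \<mu>) * (1 / sqrt ((\<mu> * T s)\<^sup>2 - 1) * (\<mu> * (lam * S s))) = G s"
      unfolding \<mu>T[OF that] real_sqrt_abs using \<sigma>(1) Snz[OF that] Gnz[OF that] \<mu>(1) \<open>lam > 0\<close>
      by auto
    with d show ?thesis by (metis diff_self)
  qed
  from has_field_derivative_zero_constant[OF \<open>convex I\<close> this]
  obtain D where D: "\<And>s. s \<in> I \<Longrightarrow> g s - \<sigma> / (lam * \<mu>) * arcosh (\<mu> * T s) = D" by auto
  show ?thesis
    by (rule that[of \<mu> \<sigma> D]) (use \<mu> \<sigma> gt1 D in \<open>auto simp: T_def algebra_simps\<close>)
qed

section \<open>From admissibility to the two catenoids\<close>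

text \<open>Smoothness is phrased by \<open>frechet_derivative\<close>, \<open>first_char\<close> by
  \<open>deriv\<close>. Direction 1 identifies the two on \<open>U\<close>, and openness of
  \<open>U\<close> carries this to the second derivative.\<close>

lemma smooth_on_deriv:
  fixes g :: "real \<Rightarrow> real"
  assumes "open U" "smooth_on g U" "s \<in> U"
  shows "(g has_real_derivative deriv g s) (at s)"
    and "(deriv g has_real_derivative deriv (deriv g) s) (at s)"
proof -
  have "Ck_on 2 g U" using assms(2) by (simp add: smooth_on_def)
  then have g: "\<And>x. x \<in> U \<Longrightarrow> g differentiable (at x)"
    and g2: "\<And>v x. x \<in> U \<Longrightarrow> (\<lambda>x. frechet_derivative g (at x) v) differentiable (at x)"
    by (auto simp: numeral_2_eq_2)
  have d: "(g has_real_derivative deriv g x) (at x)" if "x \<in> U" for x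
    using g[OF that] by (simp add: DERIV_deriv_iff_real_differentiable)
  show "(g has_real_derivative deriv g s) (at s)" by (rule d) fact
  have eq: "frechet_derivative g (at x) 1 = deriv g x" if "x \<in> U" for x
    using frechet_derivative_at[OF d[OF that, unfolded has_field_derivative_def], symmetric] by simp
  obtain c where c: "((\<lambda>x. frechet_derivative g (at x) 1) has_real_derivative c) (at s)"
    using g2[OF assms(3)] by (auto simp: real_differentiable_def)
  have "(deriv g has_real_derivative c) (at s)"
    by (rule has_field_derivative_transform_within_open[OF c assms(1,3) eq])
  then show "(deriv g has_real_derivative deriv (deriv g) s) (at s)"
    by (metis DERIV_imp_deriv)
qed

theorem mainTheorem5:
  fixes \<Omega> :: "complex set" and f :: "complex \<Rightarrow> real"
    and U :: "real set" and g :: "real \<Rightarrow> real"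
    and A :: "complex \<Rightarrow> complex" and k :: real and c0 :: complex
  assumes "admissible_pair \<Omega> f U g"
    and "associated_holomorphic \<Omega> f g A"
    and "associated_k \<Omega> A k"
    and "associated_c0 \<Omega> A k c0"
    and "k > 0"
    and "c0 = 0"
  shows "\<exists>(c1::complex) (lam::real) (\<mu>::real) (C2::real) (D::real) (\<epsilon>0::real) (\<sigma>::real).
    lam > 0 \<and> \<mu> > 0 \<and> \<epsilon>0 \<in> {1, -1} \<and> \<sigma> \<in> {1, -1} \<and>
    (\<forall>z\<in>\<Omega>. 1 \<le> lam * cmod (c1 + z) \<and>
            f z = \<epsilon>0 / lam * arcosh (lam * cmod (c1 + z)) - C2) \<and>
    (\<forall>s\<in>f ` \<Omega>. s + C2 \<noteq> 0 \<and>
            first_char g s = - 2 * lam * csch (2 * lam * (s + C2))) \<and>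
    (\<forall>s\<in>f ` \<Omega>. 1 \<le> \<mu> * cosh (lam * (s + C2)) \<and>
            g s = \<sigma> / (lam * \<mu>) * arcosh (\<mu> * cosh (lam * (s + C2))) + D) \<and>
    (\<forall>z\<in>\<Omega>. 1 \<le> lam * \<mu> * cmod (c1 + z) \<and>
            (g \<circ> f) z = \<sigma> / (lam * \<mu>) * arcosh (lam * \<mu> * cmod (c1 + z)) + D)"
proof -
  define I where "I = f ` \<Omega>"
  have \<Omega>: "open \<Omega>" "connected \<Omega>" and "smooth_on f \<Omega>"
    and minimal: "\<And>z. z \<in> \<Omega> \<Longrightarrow> (1 + (Dy f z)\<^sup>2) * Dx (Dx f) z
            - 2 * Dy (Dx f) z * Dx f z * Dy f z + (1 + (Dx f z)\<^sup>2) * Dy (Dy f) z = 0"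
    and grad: "\<And>z. z \<in> \<Omega> \<Longrightarrow> (Dx f z)\<^sup>2 + (Dy f z)\<^sup>2 \<noteq> 0"
    and U: "open U" "smooth_on g U" "I \<subseteq> U"
    and g3: "\<And>s. s \<in> U \<Longrightarrow> (deriv g s)^3 - deriv g s \<noteq> 0"
    using assms(1)
    unfolding admissible_pair_def minimal_graph_surface_def minimal_graph_transformation_def I_def
    by blast+
  show ?thesis
  proof (cases "\<Omega> = {}")
    case True
    \<comment> \<open>For empty \<open>\<Omega>\<close> the quantified clauses are vacuous; only
      positive numbers and signs must exist.\<close>
    have "\<exists>\<mu>::real. \<mu> > 0" "\<exists>\<epsilon>::real. \<epsilon> \<in> {1, -1}"
      by (auto intro: exI[of _ 1])
    then show ?thesis unfolding True by blast
  next
    case False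
    have f: "f differentiable (at z)" if "z \<in> \<Omega>" for z
      using \<open>smooth_on f \<Omega>\<close> that unfolding smooth_on_def by (metis Ck_on.simps(2))
    then have "continuous_on \<Omega> f"
      by (meson continuous_at_imp_continuous_on differentiable_imp_continuous_within)
    \<comment> \<open>The image is an interval, so a zero derivative within it forces
      constancy.\<close>
    with \<Omega> have "convex I"
      unfolding I_def by (meson connected_continuous_image is_interval_connected_1 is_interval_convex_1)
    have "I \<noteq> {}" using False by (simp add: I_def)
    have hol: "A holomorphic_on \<Omega>"
      using assms(2) unfolding associated_holomorphic_def by (rule conjunct1)
    from conjunct2[OF assms(2)[unfolded associated_holomorphic_def, folded I_def]]
    obtain H1 H where HH:
      "(\<forall>s\<in>I. (H1 has_real_derivative first_char g s) (at s within I)) \<and>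
       (\<forall>s\<in>I. (H has_real_derivative exp (- H1 s)) (at s within I)) \<and>
       (\<forall>z\<in>\<Omega>. complex_of_real (H (f z)) = A z + cnj (A z))"
      by (elim exE)
    then have H1: "\<And>s. s \<in> I \<Longrightarrow> (H1 has_real_derivative first_char g s) (at s within I)"
      and H: "\<And>s. s \<in> I \<Longrightarrow> (H has_real_derivative exp (- H1 s)) (at s within I)"
      and u: "\<And>z. z \<in> \<Omega> \<Longrightarrow> complex_of_real (H (f z)) = A z + cnj (A z)"
      by simp_all
    have df: "frechet_derivative f (at z) v = exp (H1 (f z)) * (2 * Re (deriv A z * v))"
      if "z \<in> \<Omega>" for z v
    proof -
      have "exp (- H1 (f z)) * frechet_derivative f (at z) v = 2 * Re (deriv A z * v)"
        using directional_derivative_of_potential[OF \<Omega>(1) that hol f[OF that] _ u] H that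
        unfolding I_def by blast
      then show ?thesis by (simp add: exp_minus field_simps)
    qed
    have nz: "deriv A z \<noteq> 0" if "z \<in> \<Omega>" for z
      using grad[OF that] df[OF that] by (auto simp: Dx_def Dy_def)
    \<comment> \<open>Here \<open>c0 = 0\<close> supplies the relation
      \<open>(A'' / A')^2 = k A'^2\<close>.\<close>
    obtain a c where a: "a \<noteq> 0" and c: "\<And>z. z \<in> \<Omega> \<Longrightarrow> c + z \<noteq> 0"
      and A': "\<And>z. z \<in> \<Omega> \<Longrightarrow> deriv A z = of_real (a / 2) / (c + z)"
      by (rule riccati_derivative[OF \<Omega> False hol \<open>k > 0\<close> nz])
        (use assms(4,6) in \<open>auto simp: associated_c0_def\<close>)
    obtain C where "C > 0" and "\<And>z. z \<in> \<Omega> \<Longrightarrow> cmod (c + z) = C * exp (2 * Re (A z) / a)"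
      by (rule modulus_of_log_potential[OF \<Omega> False hol a c A']; (assumption | (rule that; blast)))
    moreover have "2 * Re (A z) = H (f z)" if "z \<in> \<Omega>" for z
      using u[OF that] by (metis Re_complex_of_real complex_add_cnj)
    ultimately have modulus: "cmod (c + z) = C * exp (H (f z) / a)" if "z \<in> \<Omega>" for z
      using that by simp
    \<comment> \<open>From \<open>1 / w = cnj w / |w|^2\<close>.\<close>
    have quotient: "Re (of_real b / w) = b * Re w / (cmod w)\<^sup>2"
      "Re (of_real b / w * \<i>) = b * Im w / (cmod w)\<^sup>2" for b w
      by (simp_all add: Re_divide Im_divide cmod_power2)
    have Re_inv: "2 * Re (of_real (b / 2) / w) = b * Re w / (cmod w)\<^sup>2"
      and Im_inv: "2 * Re (of_real (b / 2) / w * \<i>) = b * Im w / (cmod w)\<^sup>2" for b w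
      unfolding quotient by simp_all
    have fx: "Dx f z = a * exp (H1 (f z)) * Re (c + z) / (cmod (c + z))\<^sup>2" if "z \<in> \<Omega>" for z
      unfolding Dx_def df[OF that] A'[OF that] mult_1_right Re_inv by (simp add: mult_ac)
    have fy: "Dy f z = a * exp (H1 (f z)) * Im (c + z) / (cmod (c + z))\<^sup>2" if "z \<in> \<Omega>" for z
      unfolding Dy_def df[OF that] A'[OF that] Im_inv by (simp add: mult_ac)
    have h: "first_char g s = - a * exp (H1 s) / (C * exp (H s / a))\<^sup>2" if "s \<in> I" for s
    proof -
      from that obtain z where z: "z \<in> \<Omega>" "s = f z" by (auto simp: I_def)
      have "((\<lambda>w. H1 (f w)) has_derivative
          (\<lambda>v. first_char g (f z) * frechet_derivative f (at z) v)) (at z within \<Omega>)"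
        using has_derivative_in_compose[of f "frechet_derivative f (at z)" z \<Omega> H1 "(*) (first_char g (f z))"]
          H1[OF that] f[OF z(1)] z unfolding has_field_derivative_def I_def
        by (metis frechet_derivative_works has_derivative_at_withinI)
      then have L: "((\<lambda>w. H1 (f w)) has_derivative
          (\<lambda>v. first_char g (f z) * frechet_derivative f (at z) v)) (at z)"
        unfolding at_within_open[OF z(1) \<Omega>(1)] .
      \<comment> \<open>The derivative of \<open>H1 (f z)\<close> is \<open>h (f z)\<close> times
        that of \<open>f\<close>. Each second derivative is thus \<open>h (f z)\<close> times a
        product of first ones, plus \<open>a exp (H1 (f z))\<close> times an entry of the Hessian of
        \<open>ln |c + z|\<close>.\<close>
      note rad = frechet_derivative_radial[OF \<Omega>(1) z(1) c[OF z(1)] L]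
      note radx = rad[of "Dx f" a Re, OF fx bounded_linear_Re]
      note rady = rad[of "Dy f" a Im, OF fy bounded_linear_Im]
      have "first_char g (f z) = - a * exp (H1 (f z)) / (cmod (c + z))\<^sup>2"
      proof (rule minimal_radial_characteristic[OF _ _ _ a fx[OF z(1)] fy[OF z(1)]])
        have xx: "Dx (Dx f) z = first_char g (f z) * (Dx f z)\<^sup>2 + a * exp (H1 (f z)) *
            (1 / (cmod (c + z))\<^sup>2 - 2 * (Re (c + z))\<^sup>2 / ((cmod (c + z))\<^sup>2)\<^sup>2)"
          using radx[of 1] unfolding Dx_def[of "Dx f"]
          by (simp add: Dx_def[symmetric] power2_eq_square power4_eq_xxxx algebra_simps)
        have xy: "Dy (Dx f) z = first_char g (f z) * Dx f z * Dy f z -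
            2 * a * exp (H1 (f z)) * Re (c + z) * Im (c + z) / ((cmod (c + z))\<^sup>2)\<^sup>2"
          using radx[of \<i>] unfolding Dy_def[of "Dx f"]
          by (simp add: Dy_def[symmetric] power2_eq_square power4_eq_xxxx algebra_simps)
        have yy: "Dy (Dy f) z = first_char g (f z) * (Dy f z)\<^sup>2 + a * exp (H1 (f z)) *
            (1 / (cmod (c + z))\<^sup>2 - 2 * (Im (c + z))\<^sup>2 / ((cmod (c + z))\<^sup>2)\<^sup>2)"
          using rady[of \<i>] unfolding Dy_def[of "Dy f"]
          by (simp add: Dy_def[symmetric] power2_eq_square power4_eq_xxxx algebra_simps)
        show "(1 + (Dy f z)\<^sup>2) * (first_char g (f z) * (Dx f z)\<^sup>2 + a * exp (H1 (f z)) *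
            (1 / (cmod (c + z))\<^sup>2 - 2 * (Re (c + z))\<^sup>2 / ((cmod (c + z))\<^sup>2)\<^sup>2))
          - 2 * (first_char g (f z) * Dx f z * Dy f z -
            2 * a * exp (H1 (f z)) * Re (c + z) * Im (c + z) / ((cmod (c + z))\<^sup>2)\<^sup>2) * Dx f z * Dy f z
          + (1 + (Dx f z)\<^sup>2) * (first_char g (f z) * (Dy f z)\<^sup>2 + a * exp (H1 (f z)) *
            (1 / (cmod (c + z))\<^sup>2 - 2 * (Im (c + z))\<^sup>2 / ((cmod (c + z))\<^sup>2)\<^sup>2)) = 0"
          using minimal[OF z(1)] unfolding xx xy yy .
      qed (simp add: c[OF z(1)], simp add: cmod_power2, simp)
      then show ?thesis unfolding modulus[OF z(1)] z(2) .
    qed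
    obtain lam C2 where lam: "lam > 0"
      and R: "\<And>s. s \<in> I \<Longrightarrow> 1 < lam * (C * exp (H s / a))"
      and sC2: "\<And>s. s \<in> I \<Longrightarrow> s + C2 = sgn a / lam * arcosh (lam * (C * exp (H s / a)))"
      and csch: "\<And>s. s \<in> I \<Longrightarrow> first_char g s = - 2 * lam * csch (2 * lam * (s + C2))"
      by (rule catenoid_profile[OF \<open>convex I\<close> \<open>I \<noteq> {}\<close> a \<open>C > 0\<close> H1 H h];
          (assumption | (rule that; blast)))
    \<comment> \<open>Keeps \<open>csch\<close> off its pole, where HOL division would return the
      default value 0.\<close>
    have C2nz: "s + C2 \<noteq> 0" if "s \<in> I" for s
      using sC2[OF that] R[OF that] lam a by (simp add: sgn_if)
    \<comment> \<open>\<open>cosh\<close> is even, so the sign of \<open>a\<close>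
      disappears.\<close>
    have cosh: "cosh (lam * (s + C2)) = lam * (C * exp (H s / a))" if "s \<in> I" for s
      using sC2[OF that] R[OF that] lam a by (auto simp: sgn_if)
    have gd: "(g has_real_derivative deriv g s) (at s within I)"
      and gdd: "(deriv g has_real_derivative
          - 2 * lam * csch (2 * lam * (s + C2)) * ((deriv g s)^3 - deriv g s)) (at s within I)"
      and gnz: "deriv g s \<noteq> 0" if "s \<in> I" for s
    proof -
      have s: "s \<in> U" using that U(3) by auto
      show "(g has_real_derivative deriv g s) (at s within I)"
        using smooth_on_deriv(1)[OF U(1,2) s] by (rule has_field_derivative_at_within)
      have "deriv (deriv g) s = first_char g s * ((deriv g s)^3 - deriv g s)"
        using g3[OF s] by (simp add: first_char_def)
      then show "(deriv g has_real_derivative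
          - 2 * lam * csch (2 * lam * (s + C2)) * ((deriv g s)^3 - deriv g s)) (at s within I)"
        using smooth_on_deriv(2)[OF U(1,2) s] csch[OF that]
        by (metis has_field_derivative_at_within)
      show "deriv g s \<noteq> 0" using g3[OF s] by auto
    qed
    obtain \<mu> \<sigma> D where \<mu>: "\<mu> > 0" and \<sigma>: "\<sigma> \<in> {1, -1}"
      and \<mu>1: "\<And>s. s \<in> I \<Longrightarrow> 1 < \<mu> * cosh (lam * (s + C2))"
      and gs: "\<And>s. s \<in> I \<Longrightarrow> g s = \<sigma> / (lam * \<mu>) * arcosh (\<mu> * cosh (lam * (s + C2))) + D"
    proof (rule catenoid_transformation[of I lam C2 g "deriv g"])
      fix \<mu> \<sigma> D
      assume "\<mu> > 0" "\<sigma> \<in> {1, -1}"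
        "\<And>s. s \<in> I \<Longrightarrow> 1 < \<mu> * cosh (lam * (s + C2))"
        "\<And>s. s \<in> I \<Longrightarrow> g s = \<sigma> / (lam * \<mu>) * arcosh (\<mu> * cosh (lam * (s + C2))) + D"
      then show thesis by (rule that)
    qed (assumption | rule \<open>convex I\<close> \<open>I \<noteq> {}\<close> lam C2nz gd gdd gnz)+
    have fI: "f z \<in> I" if "z \<in> \<Omega>" for z using that by (simp add: I_def)
    have 1: "1 \<le> lam * cmod (c + z) \<and> f z = sgn a / lam * arcosh (lam * cmod (c + z)) - C2"
      if "z \<in> \<Omega>" for z
      using R[OF fI[OF that]] sC2[OF fI[OF that]] modulus[OF that] by simp
    have 2: "1 \<le> lam * \<mu> * cmod (c + z) \<and>
        (g \<circ> f) z = \<sigma> / (lam * \<mu>) * arcosh (lam * \<mu> * cmod (c + z)) + D" if "z \<in> \<Omega>" for z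
    proof -
      \<comment> \<open>The transformed catenoid keeps the centre \<open>- c\<close>, with
        \<open>lam \<mu>\<close> in place of \<open>lam\<close>.\<close>
      have "\<mu> * cosh (lam * (f z + C2)) = lam * \<mu> * cmod (c + z)"
        using cosh[OF fI[OF that]] modulus[OF that] by simp
      with gs[OF fI[OF that]] \<mu>1[OF fI[OF that]] show ?thesis by simp
    qed
    have "sgn a \<in> {1, -1}" using a by (simp add: sgn_if)
    moreover have "\<forall>z\<in>\<Omega>. 1 \<le> lam * cmod (c + z) \<and>
        f z = sgn a / lam * arcosh (lam * cmod (c + z)) - C2"
      by (rule ballI) (rule 1)
    moreover have "\<forall>s\<in>I. s + C2 \<noteq> 0 \<and> first_char g s = - 2 * lam * csch (2 * lam * (s + C2))"
      by (intro ballI conjI C2nz csch)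
    moreover have "\<forall>s\<in>I. 1 \<le> \<mu> * cosh (lam * (s + C2)) \<and>
        g s = \<sigma> / (lam * \<mu>) * arcosh (\<mu> * cosh (lam * (s + C2))) + D"
      by (intro ballI conjI gs less_imp_le[OF \<mu>1])
    moreover have "\<forall>z\<in>\<Omega>. 1 \<le> lam * \<mu> * cmod (c + z) \<and>
        (g \<circ> f) z = \<sigma> / (lam * \<mu>) * arcosh (lam * \<mu> * cmod (c + z)) + D"
      by (rule ballI) (rule 2)
    ultimately show ?thesis
      unfolding I_def[symmetric]
      by (intro exI[of _ c] exI[of _ lam] exI[of _ \<mu>] exI[of _ C2] exI[of _ D]
          exI[of _ "sgn a"] exI[of _ \<sigma>] conjI lam \<mu> \<sigma>)
  qed
qed

end
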